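(* Let $(Y,X,A)$ be jointly distributed with $Y,A\in\{0,1\}$, let $R^*=\mathbb{E}[Y\mid X,A]$ be the Bayes optimal regressor, let $\ell:\{0,1\}^2\to[0,1]$ be a bounded loss function, and let $\widehat{R}\in[0,1]$ be an arbitrary random variable on the same probability space. Then there exist an optimal equalized odds predictor $Y^*$ and an equalized odds predictor $\widehat{Y}$ derived from $(\widehat{R},A)$ such that $$\mathbb{E}\,\ell(\widehat{Y},Y)\le\mathbb{E}\,\ell(Y^*,Y)+2\sqrt{2}\cdot d_{\mathrm{K}}(\widehat{R},R^* ).$$ The same claim holds with equalized odds replaced by equal opportunity throughout.
   Context: A predictor $\widehat{Y}\in\{0,1\}$ satisfies equalized odds if $\Pr\{\widehat{Y}=1\mid A=0,Y=y\}=\Pr\{\widehat{Y}=1\mid A=1,Y=y\}$ for $y\in\{0,1\}$, and equal opportunity if this holds for $y=1$. An optimal equalized odds (resp. equal opportunity) predictor is one minimizing $\mathbb{E}\,\ell(\cdot,Y)$ among all (possibly randomized) predictors of $(X,A)$ satisfying equalized odds (resp. equal opportunity). A predictor is derived from $(\widehat{R},A)$ if it is a possibly randomized function of $(\widehat{R},A)$ alone. The conditional Kolmogorov distance is $d_{\mathrm{K}}(R,R')=\max_{a,y\in\{0,1\}}\sup_{t\in[0,1]}\left|\Pr\{R>t\mid A=a,Y=y\}-\Pr\{R'>t\mid A=a,Y=y\}\right|$. *)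

theory Defs
  imports "HOL-Probability.Probability"
begin

text \<open>Binary labels Y, sensitive attribute A are bool-valued (False = 0, True = 1).
  A (possibly randomized) binary predictor is represented by the random variable
  f :: 'a => real giving, at each outcome, the probability of predicting 1; the
  predictor's internal randomness is independent of everything else.\<close>

definition event_ay :: "'a measure \<Rightarrow> ('a \<Rightarrow> bool) \<Rightarrow> ('a \<Rightarrow> bool) \<Rightarrow> bool \<Rightarrow> bool \<Rightarrow> 'a set" where
  "event_ay M A Y a y = {\<omega> \<in> space M. A \<omega> = a \<and> Y \<omega> = y}"

definition pos_rate :: "'a measure \<Rightarrow> ('a \<Rightarrow> bool) \<Rightarrow> ('a \<Rightarrow> bool) \<Rightarrow> ('a \<Rightarrow> real) \<Rightarrow> bool \<Rightarrow> bool \<Rightarrow> real" where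
  "pos_rate M A Y f a y =
     (\<integral>\<omega>. f \<omega> * indicator (event_ay M A Y a y) \<omega> \<partial>M) / measure M (event_ay M A Y a y)"

definition equalized_odds :: "'a measure \<Rightarrow> ('a \<Rightarrow> bool) \<Rightarrow> ('a \<Rightarrow> bool) \<Rightarrow> ('a \<Rightarrow> real) \<Rightarrow> bool" where
  "equalized_odds M A Y f = (\<forall>y. pos_rate M A Y f False y = pos_rate M A Y f True y)"

definition equal_opportunity :: "'a measure \<Rightarrow> ('a \<Rightarrow> bool) \<Rightarrow> ('a \<Rightarrow> bool) \<Rightarrow> ('a \<Rightarrow> real) \<Rightarrow> bool" where
  "equal_opportunity M A Y f = (pos_rate M A Y f False True = pos_rate M A Y f True True)"

definition exp_loss :: "'a measure \<Rightarrow> ('a \<Rightarrow> bool) \<Rightarrow> (bool \<Rightarrow> bool \<Rightarrow> real) \<Rightarrow> ('a \<Rightarrow> real) \<Rightarrow> real" where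
  "exp_loss M Y l f = (\<integral>\<omega>. f \<omega> * l True (Y \<omega>) + (1 - f \<omega>) * l False (Y \<omega>) \<partial>M)"

definition rand_pred_of :: "'a measure \<Rightarrow> 'b measure \<Rightarrow> ('a \<Rightarrow> 'b) \<Rightarrow> ('a \<Rightarrow> bool) \<Rightarrow> ('a \<Rightarrow> real) \<Rightarrow> bool" where
  "rand_pred_of M N Z A f =
     (\<exists>p :: 'b \<Rightarrow> bool \<Rightarrow> real.
        (\<lambda>(z, a). p z a) \<in> borel_measurable (N \<Otimes>\<^sub>M count_space UNIV) \<and>
        (\<forall>z a. 0 \<le> p z a \<and> p z a \<le> 1) \<and>
        (\<forall>\<omega>\<in>space M. f \<omega> = p (Z \<omega>) (A \<omega>)))"

definition optimal_fair :: "'a measure \<Rightarrow> 'b measure \<Rightarrow> ('a \<Rightarrow> 'b) \<Rightarrow> ('a \<Rightarrow> bool) \<Rightarrow> ('a \<Rightarrow> bool)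
    \<Rightarrow> (bool \<Rightarrow> bool \<Rightarrow> real) \<Rightarrow> (('a \<Rightarrow> real) \<Rightarrow> bool) \<Rightarrow> ('a \<Rightarrow> real) \<Rightarrow> bool" where
  "optimal_fair M N X A Y l fair f =
     (rand_pred_of M N X A f \<and> fair f \<and>
      (\<forall>g. rand_pred_of M N X A g \<and> fair g \<longrightarrow> exp_loss M Y l f \<le> exp_loss M Y l g))"

definition cond_tail :: "'a measure \<Rightarrow> ('a \<Rightarrow> bool) \<Rightarrow> ('a \<Rightarrow> bool) \<Rightarrow> ('a \<Rightarrow> real) \<Rightarrow> bool \<Rightarrow> bool \<Rightarrow> real \<Rightarrow> real" where
  "cond_tail M A Y R a y t =
     measure M {\<omega> \<in> event_ay M A Y a y. R \<omega> > t} / measure M (event_ay M A Y a y)"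

definition dK :: "'a measure \<Rightarrow> ('a \<Rightarrow> bool) \<Rightarrow> ('a \<Rightarrow> bool) \<Rightarrow> ('a \<Rightarrow> real) \<Rightarrow> ('a \<Rightarrow> real) \<Rightarrow> real" where
  "dK M A Y R R' = (SUP (a, y, t) \<in> UNIV \<times> UNIV \<times> {0..1}.
      \<bar>cond_tail M A Y R a y t - cond_tail M A Y R' a y t\<bar>)"

definition bayes_reg :: "'a measure \<Rightarrow> 'b measure \<Rightarrow> ('a \<Rightarrow> 'b) \<Rightarrow> ('a \<Rightarrow> bool) \<Rightarrow> ('a \<Rightarrow> bool) \<Rightarrow> ('a \<Rightarrow> real)" where
  "bayes_reg M N X A Y =
     real_cond_exp M (vimage_algebra (space M) (\<lambda>\<omega>. (X \<omega>, A \<omega>)) (N \<Otimes>\<^sub>M count_space UNIV))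
       (\<lambda>\<omega>. of_bool (Y \<omega>))"

end

theory Submission
  imports Defs
begin

text \<open>For a group \<open>a\<close>, record a predictor by its false and true positive rates. The rates reachable from
  \<open>(X, A)\<close> form the closed convex hull of the rates of the threshold rules \<open>R\<^sup>* > t\<close> and \<open>R\<^sup>* \<le> t\<close>: by
  the tower property the rates depend on a predictor linearly through \<open>R\<^sup>*\<close>, so every linear functional
  is minimised by a threshold rule (Neyman--Pearson). This region is compact, hence optimal fair
  predictors exist.

  Thresholding another score \<open>S\<close> moves each rate by at most \<open>d = d\<^sub>K(S, R\<^sup>*)\<close>, so the optimal rates of both
  groups have neighbours within \<open>d\<close> in the sup norm in the regions derived from \<open>S\<close>. Those regions are
  convex and contain \<open>(0,0)\<close> and \<open>(1,1)\<close>, which allows the two neighbours to be replaced by a fair pair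
  without leaving the box (equalized odds) or without increasing the loss beyond \<open>d\<close> (equal
  opportunity). The loss is a weighted average of the rates with slopes in \<open>[-1,1]\<close>, so the excess is at
  most \<open>d \<le> 2 \<surd>2 d\<close>.\<close>

section \<open>Planar convex regions containing the diagonal\<close>

text \<open>Every region below contains the rates of the constant predictors 0 and 1, so each of its
  points brings along the triangle that the point spans with the diagonal. The weights are
  \<open>u\<close> on \<open>(a,b)\<close>, \<open>v\<close> on \<open>(1,1)\<close> and the rest on
  \<open>(0,0)\<close>.\<close>

lemma convex_triangle_mem:
  fixes K :: "(real \<times> real) set"
  assumes K: "convex K" "(0,0) \<in> K" "(1,1) \<in> K" and q: "(a,b) \<in> K"
    and "0 \<le> u" "0 \<le> v" "u + v \<le> 1"
  shows "(u * a + v, u * b + v) \<in> K"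
proof -
  have "convex hull {(a,b),(1,1),(0,0)} \<subseteq> K"
    using assms by (intro hull_minimal) auto
  moreover have "(u * a + v, u * b + v) \<in> convex hull {(a,b),(1,1),(0,0)}"
    unfolding convex_hull_3 using assms
    by (intro CollectI exI[of _ u] exI[of _ v] exI[of _ "1 - u - v"]) simp
  ultimately show ?thesis by blast
qed

text \<open>For \<open>a < b\<close>, \<open>lo\<close> and \<open>hi\<close> put
  \<open>(c,d)\<close> on the diagonal's side of the lines joining \<open>(a,b)\<close> to
  \<open>(0,0)\<close> and to \<open>(1,1)\<close>. Together with \<open>c \<le> d\<close> these are
  the three side conditions of the triangle, written without division.\<close>

lemma above_diagonal_mem:
  fixes K :: "(real \<times> real) set"
  assumes K: "convex K" "(0,0) \<in> K" "(1,1) \<in> K" and q: "(a,b) \<in> K"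
    and "a \<le> b" "c \<le> d" "0 \<le> c" "d \<le> 1"
    and lo: "a * d \<le> c * b" and hi: "(1 - b) * (d - c) \<le> (1 - d) * (b - a)"
  shows "(c,d) \<in> K"
proof (cases "a = b")
  case True
  \<comment> \<open>The triangle is flat here; the sum of the two inequalities forces
    \<open>c = d\<close>.\<close>
  then have "a * (d - c) \<le> 0" "(1 - a) * (d - c) \<le> 0"
    using lo hi by (auto simp: algebra_simps)
  then have "d - c \<le> 0" by (simp add: algebra_simps)
  then show ?thesis
    using convex_triangle_mem[OF K q, of 0 c] assms by auto
next
  case False
  then have pos: "b - a > 0" using assms by auto
  \<comment> \<open>The solution of \<open>u * a + v = c\<close> and
    \<open>u * b + v = d\<close>.\<close>
  define u where "u = (d - c) / (b - a)"
  define v where "v = (c * b - a * d) / (b - a)"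
  have "u \<ge> 0" "v \<ge> 0" using assms pos by (auto simp: u_def v_def)
  moreover have "u + v \<le> 1"
    using pos hi by (simp add: u_def v_def field_simps flip: add_divide_distrib)
  moreover have "u * a + v = c" "u * b + v = d"
    using pos by (simp_all add: u_def v_def divide_simps) (simp_all add: algebra_simps)
  ultimately show ?thesis using convex_triangle_mem[OF K q, of u v] by simp
qed

text \<open>By \<open>F\<close> the point \<open>(c,d)\<close> lies beyond the edge from
  \<open>(0,0)\<close> to \<open>(a,b)\<close>, and by \<open>G\<close> it lies inside the line from
  \<open>(a,b)\<close> to \<open>(1,1)\<close>. So the first edge meets the edge from
  \<open>(c,d)\<close> to \<open>(1,1)\<close>. The meeting point is below \<open>(a,b)\<close> and
  above \<open>(c,d)\<close> in both coordinates, hence in every box that holds these two.\<close>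

lemma above_diagonal_crossing:
  fixes K L B :: "(real \<times> real) set"
  assumes K: "convex K" "(0,0) \<in> K" "(1,1) \<in> K" and L: "convex L" "(0,0) \<in> L" "(1,1) \<in> L"
    and q: "(a,b) \<in> K" "(c,d) \<in> L"
    and ab: "a \<le> b" "0 \<le> a" "b \<le> 1" and cd: "c \<le> d" "0 \<le> c" "d \<le> 1"
    and F: "c * b < a * d" and G: "(1 - d) * (b - a) > (1 - b) * (d - c)"
    and B: "(a,b) \<in> cbox p r" "(c,d) \<in> cbox p r"
  shows "K \<inter> L \<inter> cbox p r \<noteq> {}"
proof -
  \<comment> \<open>Cramer's rule for the point \<open>s\<close> times \<open>(a,b)\<close> that
    equals \<open>1 - t\<close> times \<open>(c,d)\<close> plus \<open>t\<close> times
    \<open>(1,1)\<close>; \<open>D\<close> is the determinant.\<close>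
  define D where "D = (b - a) + (a * d - c * b)"
  have D: "D > 0" using F ab by (simp add: D_def)
  define s where "s = (d - c) / D"
  define t where "t = (a * d - c * b) / D"
  have s: "0 \<le> s" "s \<le> 1" using D cd G by (auto simp: s_def D_def algebra_simps)
  have t: "0 \<le> t" "t \<le> 1" using D F ab by (auto simp: t_def D_def)
  have e: "s * a = (1 - t) * c + t" "s * b = (1 - t) * d + t"
    using D by (simp_all add: s_def t_def divide_simps) (simp_all add: D_def algebra_simps)
  have "(s * a, s * b) \<in> K" using convex_triangle_mem[OF K q(1), of s 0] s by simp
  moreover have "(s * a, s * b) \<in> L"
    unfolding e using convex_triangle_mem[OF L q(2), of "1 - t" t] t by simp
  moreover have "s * a \<le> a" "s * b \<le> b" using s ab by (auto intro: mult_left_le_one_le)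
  moreover have "c \<le> s * a" "d \<le> s * b"
  proof -
    have "t * (1 - c) \<ge> 0" "t * (1 - d) \<ge> 0" using t cd by auto
    then show "c \<le> s * a" "d \<le> s * b" unfolding e by (auto simp: algebra_simps)
  qed
  ultimately have "(s * a, s * b) \<in> K \<inter> L \<inter> cbox p r"
    using B by (cases p; cases r) (auto simp: cbox_Pair_iff)
  then show ?thesis by blast
qed

text \<open>The two triangles over the diagonal either have one apex inside the other, or their edges
  cross at a point coordinatewise between the apices.\<close>

lemma above_diagonal_common_point:
  fixes K L :: "(real \<times> real) set"
  assumes K: "convex K" "(0,0) \<in> K" "(1,1) \<in> K" and L: "convex L" "(0,0) \<in> L" "(1,1) \<in> L"
    and q: "(a,b) \<in> K" "(c,d) \<in> L"
    and ab: "a \<le> b" "0 \<le> a" "b \<le> 1" and cd: "c \<le> d" "0 \<le> c" "d \<le> 1"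
    and B: "(a,b) \<in> cbox p r" "(c,d) \<in> cbox p r"
  shows "K \<inter> L \<inter> cbox p r \<noteq> {}"
proof -
  consider (l) "a * d \<le> c * b" "(1 - b) * (d - c) \<le> (1 - d) * (b - a)"
    | (k) "a * d \<ge> c * b" "(1 - b) * (d - c) \<ge> (1 - d) * (b - a)"
    | (kl) "c * b < a * d" "(1 - d) * (b - a) > (1 - b) * (d - c)"
    | (lk) "a * d < c * b" "(1 - b) * (d - c) > (1 - d) * (b - a)"
    by linarith
  then show ?thesis
  proof cases
    case l
    then have "(c,d) \<in> K" using above_diagonal_mem[OF K q(1) ab(1) cd] by simp
    then show ?thesis using q B by blast
  next
    case k
    then have "(a,b) \<in> L" using above_diagonal_mem[OF L q(2) cd(1) ab] by (simp add: mult.commute)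
    then show ?thesis using q B by blast
  next
    case kl
    then show ?thesis using above_diagonal_crossing[OF K L q ab cd _ _ B] by simp
  next
    case lk
    then show ?thesis
      using above_diagonal_crossing[OF L K q(2,1) cd ab _ _ B(2,1)] by (simp add: ac_simps)
  qed
qed

text \<open>The segment between points on opposite sides of the diagonal crosses it. The crossing
  point stays in the convex box, and the diagonal of the unit square belongs to both
  regions.\<close>

lemma opposite_sides_common_point:
  fixes K L :: "(real \<times> real) set"
  assumes K: "convex K" "(0,0) \<in> K" "(1,1) \<in> K" and L: "convex L" "(0,0) \<in> L" "(1,1) \<in> L"
    and ab: "a \<le> b" "0 \<le> a" "b \<le> 1" and cd: "d \<le> c" "0 \<le> d" "c \<le> 1"
    and B: "(a,b) \<in> cbox p r" "(c,d) \<in> cbox p r"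
  shows "K \<inter> L \<inter> cbox p r \<noteq> {}"
proof (cases "a = b \<and> c = d")
  case True
  then have "(a,b) \<in> K" "(a,b) \<in> L"
    using convex_triangle_mem[OF K K(2), of 0 a] convex_triangle_mem[OF L L(2), of 0 a] ab by auto
  then show ?thesis using B by blast
next
  case False
  define D where "D = (b - a) + (c - d)"
  have D: "D > 0" using False ab cd by (auto simp: D_def)
  \<comment> \<open>Weights inversely proportional to the heights \<open>b - a\<close> and
    \<open>c - d\<close> over the diagonal make the two coordinates agree.\<close>
  define s where "s = (c - d) / D"
  have s: "0 \<le> s" "s \<le> 1" using D ab cd by (auto simp: s_def D_def)
  have e: "s * a + (1 - s) * c = s * b + (1 - s) * d"
    using D by (simp add: s_def divide_simps) (simp add: D_def algebra_simps)
  define x where "x = s * a + (1 - s) * c"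
  have x: "(x,x) = s *\<^sub>R (a,b) + (1 - s) *\<^sub>R (c,d)"
    using e by (simp add: x_def)
  have "(x,x) \<in> cbox p r"
    unfolding x using B s by (intro convexD convex_box) auto
  moreover have "0 \<le> x" "x \<le> 1"
  proof -
    show "0 \<le> x" using s ab cd by (simp add: x_def)
    have "s * a + (1 - s) * c \<le> s * 1 + (1 - s) * 1"
      using s ab cd by (intro add_mono mult_left_mono) auto
    then show "x \<le> 1" by (simp add: x_def)
  qed
  then have "(x,x) \<in> K" "(x,x) \<in> L"
    using convex_triangle_mem[OF K K(2), of 0 x] convex_triangle_mem[OF L L(2), of 0 x] by auto
  ultimately show ?thesis by blast
qed

text \<open>A common point is a rate pair that both groups can realize, which is what equalized odds
  asks for; the box keeps it close to the target rates. The cases are the sides of the diagonal on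
  which the two points lie.\<close>

lemma diagonal_convex_common_point:
  fixes K L :: "(real \<times> real) set"
  assumes K: "convex K" "(0,0) \<in> K" "(1,1) \<in> K" "K \<subseteq> cbox (0,0) (1,1)"
    and L: "convex L" "(0,0) \<in> L" "(1,1) \<in> L" "L \<subseteq> cbox (0,0) (1,1)"
    and q: "q \<in> K" "q' \<in> L" and B: "q \<in> cbox p r" "q' \<in> cbox p r"
  shows "K \<inter> L \<inter> cbox p r \<noteq> {}"
proof -
  obtain a b c d where e: "q = (a,b)" "q' = (c,d)" by (cases q; cases q') auto
  obtain p1 p2 r1 r2 where pr: "p = (p1,p2)" "r = (r1,r2)" by (cases p; cases r) auto
  have bd: "0 \<le> a" "0 \<le> b" "0 \<le> c" "0 \<le> d" "a \<le> 1" "b \<le> 1" "c \<le> 1" "d \<le> 1"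
    using K(4) L(4) q e by (auto simp: cbox_Pair_iff)
  have swap: "prod.swap ` S = {(y,x). (x,y) \<in> S}" for S :: "(real \<times> real) set" by auto
  have lin: "linear (prod.swap :: real \<times> real \<Rightarrow> real \<times> real)"
    by (auto intro!: linearI)
  consider "a \<le> b" "c \<le> d" | "a \<le> b" "d \<le> c" | "b \<le> a" "c \<le> d" | "b \<le> a" "d \<le> c" by linarith
  then show ?thesis
  proof cases
    case 1
    then show ?thesis using above_diagonal_common_point[OF K(1-3) L(1-3)] q B bd unfolding e by blast
  next
    case 2
    then show ?thesis using opposite_sides_common_point[OF K(1-3) L(1-3)] B bd unfolding e by blast
  next
    case 3
    then show ?thesis using opposite_sides_common_point[OF L(1-3) K(1-3)] B bd unfolding e by blast
  next
    case 4
    \<comment> \<open>Reflection in the diagonal carries two points below it to two points above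
      it.\<close>
    have "prod.swap ` K \<inter> prod.swap ` L \<inter> cbox (p2,p1) (r2,r1) \<noteq> {}"
      using 4 q B bd K L unfolding e pr
      by (intro above_diagonal_common_point[of _ _ b a d c] convex_linear_image lin)
        (auto simp: swap cbox_Pair_iff)
    then show ?thesis unfolding pr by (auto simp: cbox_Pair_iff)
  qed
qed

text \<open>The point with the larger second coordinate is moved towards \<open>(0,0)\<close> or the other one towards
  \<open>(1,1)\<close>, whichever does not increase the cost \<open>c\<close> of the first coordinate.\<close>

lemma level_second_coordinate:
  fixes K L :: "(real \<times> real) set"
  assumes K: "convex K" "(1,1) \<in> K" and L: "convex L" "(0,0) \<in> L"
    and q: "q \<in> K" "q' \<in> L" and le: "snd q \<le> snd q'"
    and bd: "q \<in> cbox (0,0) (1,1)" "q' \<in> cbox (0,0) (1,1)"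
  obtains r r' where "r \<in> K" "r' \<in> L" "snd r = snd r'" "snd r \<in> {snd q, snd q'}"
    "c * fst r \<le> c * fst q" "c * fst r' \<le> c * fst q'"
proof -
  obtain x y x' y' where e: "q = (x,y)" "q' = (x',y')" by (cases q; cases q') auto
  have b: "0 \<le> x" "x \<le> 1" "0 \<le> y" "y \<le> 1" "0 \<le> x'" "x' \<le> 1" "0 \<le> y'" "y' \<le> 1" "y \<le> y'"
    using bd le by (auto simp: e cbox_Pair_iff)
  show ?thesis
  proof (cases "c \<ge> 0")
    case True
    \<comment> \<open>If \<open>y' = 0\<close> then \<open>y = 0\<close> as well, and the value 0 of
      the quotient still gives \<open>s * y' = y\<close>.\<close>
    define s where "s = y / y'"
    have s: "0 \<le> s" "s \<le> 1" "s * y' = y"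
      using b by (auto simp: s_def divide_le_eq_1)
    have "s *\<^sub>R q' + (1 - s) *\<^sub>R (0,0) \<in> L"
      using s L q by (intro convexD) auto
    then have "(s * x', y) \<in> L" using s by (simp add: e)
    moreover have "c * (s * x') \<le> c * x'"
      using True s b by (intro mult_left_mono mult_left_le_one_le) auto
    ultimately show ?thesis using that[of "(x,y)" "(s * x', y)"] q by (simp add: e)
  next
    case False
    \<comment> \<open>Likewise \<open>y = 1\<close> forces \<open>y' = 1\<close>, so division by
      zero again yields the right value.\<close>
    define s where "s = (1 - y') / (1 - y)"
    have s: "0 \<le> s" "s \<le> 1" "s * (1 - y) = 1 - y'"
      using b by (auto simp: s_def divide_le_eq_1)
    have "s *\<^sub>R q + (1 - s) *\<^sub>R (1,1) \<in> K"
      using s K q by (intro convexD) auto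
    moreover have "s * y + (1 - s) = y'" using s(3) by (simp add: algebra_simps)
    ultimately have "(s * x + (1 - s), y') \<in> K" by (simp add: e)
    moreover have "c * (s * x + (1 - s)) \<le> c * x"
    proof -
      have "(1 - s) * (1 - x) \<ge> 0" using s b by simp
      then show ?thesis using False by (intro mult_left_mono_neg) (auto simp: algebra_simps)
    qed
    ultimately show ?thesis using that[of "(s * x + (1 - s), y')" "(x',y')"] q by (simp add: e)
  qed
qed

lemma signed_product_le:
  fixes c x d :: real
  assumes "\<bar>c\<bar> \<le> 1" "\<bar>x\<bar> \<le> d"
  shows "c * x \<le> d"
proof -
  have "c * x \<le> \<bar>c\<bar> * \<bar>x\<bar>" by (simp flip: abs_mult)
  also have "\<dots> \<le> 1 * d" using assms by (intro mult_mono) auto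
  finally show ?thesis by simp
qed

section \<open>Threshold rules\<close>

text \<open>An affine function on the unit interval changes sign at most once, so up to its zeros
  the set where it is negative is cut out by one threshold, with \<open>b\<close> telling on which
  side. The threshold is the root \<open>u / (u - v)\<close> if the signs of \<open>u\<close> and
  \<open>v\<close> differ.\<close>

lemma threshold_optimal:
  fixes u v :: real
  obtains t b where "0 \<le> t" "t \<le> 1"
    "\<And>r. 0 \<le> r \<Longrightarrow> r \<le> 1 \<Longrightarrow> u * (1 - r) + v * r < 0 \<Longrightarrow> (r > t) = b"
    "\<And>r. 0 \<le> r \<Longrightarrow> r \<le> 1 \<Longrightarrow> u * (1 - r) + v * r > 0 \<Longrightarrow> (r > t) \<noteq> b"
proof -
  consider (n) "u < 0" "v < 0" | (p) "u \<ge> 0" "v \<ge> 0" | (up) "u < 0" "v \<ge> 0" | (dn) "u \<ge> 0" "v < 0"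
    by linarith
  then show ?thesis
  proof cases
    case n
    \<comment> \<open>No \<open>r\<close> in the unit interval exceeds 1, so threshold 1 gives the
      rule that accepts everything for \<open>b = False\<close> and nothing for
      \<open>b = True\<close>.\<close>
    have "u * (1 - r) + v * r \<le> 0" if "0 \<le> r" "r \<le> 1" for r
      using n that by (intro add_nonpos_nonpos) (auto simp: mult_nonpos_nonneg)
    then show ?thesis using that[of 1 False] by force
  next
    case p
    have "u * (1 - r) + v * r \<ge> 0" if "0 \<le> r" "r \<le> 1" for r
      using p that by auto
    then show ?thesis using that[of 1 True] by force
  next
    case up
    then have "v - u > 0" by auto
    then have "0 \<le> u / (u - v)" "u / (u - v) \<le> 1" "\<And>r. (r > u / (u - v)) = (u * (1 - r) + v * r > 0)"
      using up by (auto simp: field_simps)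
    then show ?thesis using that[of "u / (u - v)" False] by force
  next
    case dn
    then have "u - v > 0" by auto
    then have "0 \<le> u / (u - v)" "u / (u - v) \<le> 1" "\<And>r. (r > u / (u - v)) = (u * (1 - r) + v * r < 0)"
      using dn by (auto simp: field_simps)
    then show ?thesis using that[of "u / (u - v)" True] by force
  qed
qed

text \<open>Indicators of rays need not converge along an arbitrary sequence of thresholds, but
  along a monotone one each point is eventually always in or always out. The limit set may fail to
  be of the form \<open>s > t\<close>, for instance when thresholds increase to a limit; this is why
  only a Borel set is claimed.\<close>

lemma monotone_threshold_limit:
  fixes t :: "nat \<Rightarrow> real"
  obtains k B where "strict_mono k" "B \<in> sets borel"
    "\<And>s. \<forall>\<^sub>F n in sequentially. (s > t (k n)) = (s \<in> B)"
proof -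
  obtain k where k: "strict_mono k" "monoseq (\<lambda>n. t (k n))" using seq_monosub by blast
  \<comment> \<open>The limit inferior of the rays. A point outside it is infinitely often excluded,
    and monotonicity turns this into exclusion for all large indices.\<close>
  define B where "B = (\<Union>m. \<Inter>n\<in>{m..}. {s. s > t (k n)})"
  have "B \<in> sets borel" unfolding B_def by measurable
  moreover have "\<forall>\<^sub>F n in sequentially. (s > t (k n)) = (s \<in> B)" for s
  proof (cases "s \<in> B")
    case True
    then show ?thesis by (auto simp: B_def eventually_sequentially)
  next
    case False
    then have *: "\<exists>n\<ge>m. s \<le> t (k n)" for m by (auto simp: B_def not_less)
    from k(2) have "\<exists>m. \<forall>n\<ge>m. s \<le> t (k n)"
      unfolding monoseq_iff
    proof
      assume "incseq (\<lambda>n. t (k n))"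
      then show ?thesis using *[of 0] by (meson incseqD order_trans)
    next
      assume "decseq (\<lambda>n. t (k n))"
      then have "s \<le> t (k n)" for n
        using *[of n] unfolding decseq_def by (meson order_trans)
      then show ?thesis by blast
    qed
    then show ?thesis using False by (auto simp: eventually_sequentially not_less)
  qed
  ultimately show ?thesis using that k(1) by blast
qed

section \<open>Achievable rates\<close>

lemma rand_pred_of_bounds:
  assumes "rand_pred_of M N Z A f" "\<omega> \<in> space M"
  shows "0 \<le> f \<omega>" "f \<omega> \<le> 1"
  using assms unfolding rand_pred_of_def by auto

lemma rand_pred_of_measurable:
  assumes "rand_pred_of M N Z A f"
    and Z: "Z \<in> measurable M N" and A: "A \<in> measurable M (count_space UNIV)"
  shows "f \<in> borel_measurable M"
proof -
  obtain p where p: "(\<lambda>(z, a). p z a) \<in> borel_measurable (N \<Otimes>\<^sub>M count_space UNIV)"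
    and f: "\<And>\<omega>. \<omega> \<in> space M \<Longrightarrow> f \<omega> = p (Z \<omega>) (A \<omega>)"
    using assms(1) unfolding rand_pred_of_def by blast
  have "(\<lambda>\<omega>. (\<lambda>(z, a). p z a) (Z \<omega>, A \<omega>)) \<in> borel_measurable M"
    using Z A by (intro measurable_compose[OF _ p]) auto
  then show ?thesis using f by (subst measurable_cong[where g = "\<lambda>\<omega>. p (Z \<omega>) (A \<omega>)"]) auto
qed

lemma rand_pred_of_const:
  assumes "0 \<le> c" "c \<le> 1"
  shows "rand_pred_of M N Z A (\<lambda>_. c)"
  unfolding rand_pred_of_def using assms by (intro exI[of _ "\<lambda>_ _. c"]) auto

text \<open>Predictors see \<open>A\<close>, so the rules for the two groups can be chosen
  independently. The jointly reachable rates therefore form a product of two planar regions.\<close>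

lemma rand_pred_of_combine:
  assumes "rand_pred_of M N Z A f" "rand_pred_of M N Z A g"
  obtains h where "rand_pred_of M N Z A h"
    "\<And>\<omega>. \<omega> \<in> space M \<Longrightarrow> A \<omega> = False \<Longrightarrow> h \<omega> = f \<omega>"
    "\<And>\<omega>. \<omega> \<in> space M \<Longrightarrow> A \<omega> = True \<Longrightarrow> h \<omega> = g \<omega>"
proof -
  obtain p q where p [measurable]: "(\<lambda>(z, a). p z a) \<in> borel_measurable (N \<Otimes>\<^sub>M count_space UNIV)"
    and f: "\<And>z a. 0 \<le> p z a \<and> p z a \<le> 1" "\<And>\<omega>. \<omega> \<in> space M \<Longrightarrow> f \<omega> = p (Z \<omega>) (A \<omega>)"
    and q [measurable]: "(\<lambda>(z, a). q z a) \<in> borel_measurable (N \<Otimes>\<^sub>M count_space UNIV)"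
    and g: "\<And>z a. 0 \<le> q z a \<and> q z a \<le> 1" "\<And>\<omega>. \<omega> \<in> space M \<Longrightarrow> g \<omega> = q (Z \<omega>) (A \<omega>)"
    using assms unfolding rand_pred_of_def by blast
  have "(\<lambda>x. if snd x then (\<lambda>(z, a). q z a) x else (\<lambda>(z, a). p z a) x)
      \<in> borel_measurable (N \<Otimes>\<^sub>M count_space (UNIV :: bool set))"
    by measurable
  then have "(\<lambda>(z, a). if a then q z a else p z a)
      \<in> borel_measurable (N \<Otimes>\<^sub>M count_space (UNIV :: bool set))"
    by (simp add: case_prod_beta cong: if_cong)
  then have "rand_pred_of M N Z A (\<lambda>\<omega>. if A \<omega> then q (Z \<omega>) (A \<omega>) else p (Z \<omega>) (A \<omega>))"
    unfolding rand_pred_of_def using f(1) g(1)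
    by (intro exI[of _ "\<lambda>z a. if a then q z a else p z a"]) auto
  then show ?thesis using that f(2) g(2) by force
qed

lemma rand_pred_of_convex:
  assumes "rand_pred_of M N Z A f" "rand_pred_of M N Z A g" "0 \<le> u" "0 \<le> v" "u + v = (1::real)"
  shows "rand_pred_of M N Z A (\<lambda>\<omega>. u * f \<omega> + v * g \<omega>)"
proof -
  obtain p q where p [measurable]: "(\<lambda>(z, a). p z a) \<in> borel_measurable (N \<Otimes>\<^sub>M count_space UNIV)"
    and f: "\<And>z a. 0 \<le> p z a \<and> p z a \<le> 1" "\<And>\<omega>. \<omega> \<in> space M \<Longrightarrow> f \<omega> = p (Z \<omega>) (A \<omega>)"
    and q [measurable]: "(\<lambda>(z, a). q z a) \<in> borel_measurable (N \<Otimes>\<^sub>M count_space UNIV)"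
    and g: "\<And>z a. 0 \<le> q z a \<and> q z a \<le> 1" "\<And>\<omega>. \<omega> \<in> space M \<Longrightarrow> g \<omega> = q (Z \<omega>) (A \<omega>)"
    using assms unfolding rand_pred_of_def by blast
  have "(\<lambda>x. u * (\<lambda>(z, a). p z a) x + v * (\<lambda>(z, a). q z a) x)
      \<in> borel_measurable (N \<Otimes>\<^sub>M count_space (UNIV :: bool set))"
    by measurable
  then have "(\<lambda>(z, a). u * p z a + v * q z a)
      \<in> borel_measurable (N \<Otimes>\<^sub>M count_space (UNIV :: bool set))"
    by (simp add: case_prod_beta)
  then show ?thesis
    unfolding rand_pred_of_def using f g assms(3-)
    by (intro exI[of _ "\<lambda>z a. u * p z a + v * q z a"]) (auto intro: convex_bound_le)
qed

section \<open>Rate regions and the loss as a function of rates\<close>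

definition rates :: "'a measure \<Rightarrow> ('a \<Rightarrow> bool) \<Rightarrow> ('a \<Rightarrow> bool) \<Rightarrow> bool \<Rightarrow> ('a \<Rightarrow> real) \<Rightarrow> real \<times> real" where
  "rates M A Y a f = (pos_rate M A Y f a False, pos_rate M A Y f a True)"

definition achievable ::
    "'a measure \<Rightarrow> 'b measure \<Rightarrow> ('a \<Rightarrow> 'b) \<Rightarrow> ('a \<Rightarrow> bool) \<Rightarrow> ('a \<Rightarrow> bool) \<Rightarrow> bool \<Rightarrow> (real \<times> real) set" where
  "achievable M N Z A Y a = rates M A Y a ` {f. rand_pred_of M N Z A f}"

text \<open>Closing the threshold curves before taking the hull gives the hull of a compact planar
  set, hence a compact set. Both orientations \<open>b\<close> occur because an arbitrary loss may
  favour the reversed rule, and \<open>t\<close> is confined to the range over which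
  \<open>dK\<close> takes its supremum.\<close>

definition threshold_hull ::
    "'a measure \<Rightarrow> ('a \<Rightarrow> bool) \<Rightarrow> ('a \<Rightarrow> bool) \<Rightarrow> ('a \<Rightarrow> real) \<Rightarrow> bool \<Rightarrow> (real \<times> real) set" where
  "threshold_hull M A Y S a =
     convex hull (\<Union>b. closure ((\<lambda>t. rates M A Y a (\<lambda>\<omega>. of_bool ((S \<omega> > t) = b))) ` {0..1}))"

text \<open>The expected loss less that of the constant predictor 0.\<close>

definition rates_loss ::
    "'a measure \<Rightarrow> ('a \<Rightarrow> bool) \<Rightarrow> ('a \<Rightarrow> bool) \<Rightarrow> (bool \<Rightarrow> bool \<Rightarrow> real) \<Rightarrow> real \<times> real \<Rightarrow> real \<times> real \<Rightarrow> real" where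
  "rates_loss M A Y l p q =
     (l True False - l False False) * (measure M (event_ay M A Y False False) * fst p
        + measure M (event_ay M A Y True False) * fst q)
   + (l True True - l False True) * (measure M (event_ay M A Y False True) * snd p
        + measure M (event_ay M A Y True True) * snd q)"

locale labelled_population = prob_space M for M :: "'a measure" +
  fixes A Y :: "'a \<Rightarrow> bool"
  assumes A [measurable]: "A \<in> measurable M (count_space UNIV)"
    and Y [measurable]: "Y \<in> measurable M (count_space UNIV)"
    and pos: "measure M (event_ay M A Y a y) > 0"
begin

abbreviation "E \<equiv> event_ay M A Y"
abbreviation "rate \<equiv> rates M A Y"

lemma event_measurable [measurable]: "E a y \<in> sets M"
  unfolding event_ay_def by measurable

lemma integrable_bounded:
  fixes f :: "'a \<Rightarrow> real"
  assumes "f \<in> borel_measurable M" "\<And>\<omega>. \<omega> \<in> space M \<Longrightarrow> \<bar>f \<omega>\<bar> \<le> B"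
  shows "integrable M f"
  using assms by (intro integrable_const_bound[of _ B]) auto

lemma integrable_event:
  fixes f :: "'a \<Rightarrow> real"
  assumes "f \<in> borel_measurable M" "\<And>\<omega>. \<omega> \<in> space M \<Longrightarrow> 0 \<le> f \<omega> \<and> f \<omega> \<le> 1"
  shows "integrable M (\<lambda>\<omega>. f \<omega> * indicator (E a y) \<omega>)"
  using assms by (intro integrable_bounded[of _ 1]) (auto simp: indicator_def)

lemma pos_rate_cong:
  assumes "\<And>\<omega>. \<omega> \<in> space M \<Longrightarrow> A \<omega> = a \<Longrightarrow> f \<omega> = g \<omega>"
  shows "pos_rate M A Y f a y = pos_rate M A Y g a y"
  unfolding pos_rate_def using assms
  by (intro arg_cong2[of _ _ _ _ "(/)"] Bochner_Integration.integral_cong) (auto simp: event_ay_def indicator_def)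

lemma rate_cong:
  assumes "\<And>\<omega>. \<omega> \<in> space M \<Longrightarrow> A \<omega> = a \<Longrightarrow> f \<omega> = g \<omega>"
  shows "rate a f = rate a g"
  using pos_rate_cong[of a f g] assms by (auto simp: rates_def)

lemma pos_rate_bounds:
  assumes f: "f \<in> borel_measurable M" "\<And>\<omega>. \<omega> \<in> space M \<Longrightarrow> 0 \<le> f \<omega> \<and> f \<omega> \<le> 1"
  shows "0 \<le> pos_rate M A Y f a y" "pos_rate M A Y f a y \<le> 1"
proof -
  show "0 \<le> pos_rate M A Y f a y"
    unfolding pos_rate_def using f by (intro divide_nonneg_nonneg integral_nonneg) auto
  have "integrable M (indicator (E a y) :: 'a \<Rightarrow> real)"
    by (rule integrable_bounded[of _ 1]) (auto simp: indicator_def)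
  then have "(\<integral>\<omega>. f \<omega> * indicator (E a y) \<omega> \<partial>M) \<le> (\<integral>\<omega>. indicator (E a y) \<omega> \<partial>M)"
    using integrable_event[OF f] f(2) by (intro integral_mono) (auto intro: mult_left_le_one_le)
  then show "pos_rate M A Y f a y \<le> 1"
    unfolding pos_rate_def using pos[of a y] by simp
qed

lemma rate_in_cbox:
  assumes f: "f \<in> borel_measurable M" "\<And>\<omega>. \<omega> \<in> space M \<Longrightarrow> 0 \<le> f \<omega> \<and> f \<omega> \<le> 1"
  shows "rate a f \<in> cbox (0,0) (1,1)"
  using pos_rate_bounds[OF f] by (simp add: rates_def cbox_Pair_iff)

lemma pos_rate_const: "pos_rate M A Y (\<lambda>_. c) a y = c"
  using pos[of a y] by (simp add: pos_rate_def)

lemma pos_rate_tendsto: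
  assumes f: "\<And>n. f n \<in> borel_measurable M" "\<And>n \<omega>. \<omega> \<in> space M \<Longrightarrow> 0 \<le> f n \<omega> \<and> f n \<omega> \<le> 1"
    and g: "g \<in> borel_measurable M"
    and lim: "\<And>\<omega>. \<omega> \<in> space M \<Longrightarrow> (\<lambda>n. f n \<omega>) \<longlonglongrightarrow> g \<omega>"
  shows "(\<lambda>n. pos_rate M A Y (f n) a y) \<longlonglongrightarrow> pos_rate M A Y g a y"
  unfolding pos_rate_def
proof (intro tendsto_divide tendsto_const)
  show "(\<lambda>n. \<integral>\<omega>. f n \<omega> * indicator (E a y) \<omega> \<partial>M) \<longlonglongrightarrow> (\<integral>\<omega>. g \<omega> * indicator (E a y) \<omega> \<partial>M)"
  proof (rule integral_dominated_convergence[where w = "\<lambda>_. 1"])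
    show "AE \<omega> in M. (\<lambda>n. f n \<omega> * indicator (E a y) \<omega>) \<longlonglongrightarrow> g \<omega> * indicator (E a y) \<omega>"
      using lim by (intro AE_I2 tendsto_intros) auto
    show "AE \<omega> in M. norm (f n \<omega> * indicator (E a y) \<omega>) \<le> 1" for n
      using f(2)[of _ n] by (intro AE_I2) (auto simp: indicator_def)
  qed (use f g in \<open>auto\<close>)
qed (use pos[of a y] in auto)

text \<open>The integrand is affine in \<open>f\<close> with a slope that depends on
  \<open>Y\<close> only. Splitting it over the four cells of \<open>(A, Y)\<close>, each of positive
  mass, leaves \<open>f\<close> visible only through its rates.\<close>

lemma exp_loss_rates:
  assumes f [measurable]: "f \<in> borel_measurable M" and bd: "\<And>\<omega>. \<omega> \<in> space M \<Longrightarrow> 0 \<le> f \<omega> \<and> f \<omega> \<le> 1"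
  shows "exp_loss M Y l f = (\<integral>\<omega>. l False (Y \<omega>) \<partial>M) + rates_loss M A Y l (rate False f) (rate True f)"
proof -
  have *: "(\<integral>\<omega>. f \<omega> * indicator (E a y) \<omega> \<partial>M) = measure M (E a y) * pos_rate M A Y f a y" for a y
    using pos[of a y] by (simp add: pos_rate_def)
  have [measurable]: "(\<lambda>\<omega>. l False (Y \<omega>)) \<in> borel_measurable M" by measurable
  have i: "integrable M (\<lambda>\<omega>. l False (Y \<omega>))"
    by (intro integrable_bounded[of _ "max \<bar>l False True\<bar> \<bar>l False False\<bar>"]) (auto, metis (full_types) max.cobounded1 max.cobounded2)
  have "exp_loss M Y l f = (\<integral>\<omega>. l False (Y \<omega>)
      + ((l True False - l False False) * (f \<omega> * indicator (E False False) \<omega>)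
      + (l True False - l False False) * (f \<omega> * indicator (E True False) \<omega>)
      + (l True True - l False True) * (f \<omega> * indicator (E False True) \<omega>)
      + (l True True - l False True) * (f \<omega> * indicator (E True True) \<omega>)) \<partial>M)"
    unfolding exp_loss_def
    by (intro Bochner_Integration.integral_cong refl)
      (auto simp: indicator_def event_ay_def algebra_simps)
  also have "\<dots> = (\<integral>\<omega>. l False (Y \<omega>) \<partial>M) + rates_loss M A Y l (rate False f) (rate True f)"
    using integrable_event[OF f bd] i
    by (simp add: rates_loss_def rates_def *) (simp add: algebra_simps)
  finally show ?thesis .
qed

section \<open>Compactness and convexity of the rate regions\<close>

lemma compact_threshold_hull:
  assumes [measurable]: "S \<in> borel_measurable M"
  shows "compact (threshold_hull M A Y S a)"
proof -
  have "compact (closure ((\<lambda>t. rate a (\<lambda>\<omega>. of_bool ((S \<omega> > t) = b))) ` {0..1}))" for b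
    unfolding compact_closure
    by (intro bounded_subset[OF bounded_cbox[of "(0,0)" "(1,1)"]] image_subsetI rate_in_cbox) auto
  then show ?thesis
    unfolding threshold_hull_def by (intro compact_convex_hull compact_UN) auto
qed

lemma convex_achievable:
  assumes Z: "Z \<in> measurable M N"
  shows "convex (achievable M N Z A Y a)"
proof (rule convexI)
  fix p q :: "real \<times> real" and u v :: real
  assume pq: "p \<in> achievable M N Z A Y a" "q \<in> achievable M N Z A Y a"
    and uv: "0 \<le> u" "0 \<le> v" "u + v = 1"
  obtain f g where f: "rand_pred_of M N Z A f" "p = rate a f"
    and g: "rand_pred_of M N Z A g" "q = rate a g"
    using pq unfolding achievable_def by blast
  have "pos_rate M A Y (\<lambda>\<omega>. u * f \<omega> + v * g \<omega>) a y = u * pos_rate M A Y f a y + v * pos_rate M A Y g a y" for y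
  proof -
    have "integrable M (\<lambda>\<omega>. f \<omega> * indicator (E a y) \<omega>)" "integrable M (\<lambda>\<omega>. g \<omega> * indicator (E a y) \<omega>)"
      using f g Z A by (auto intro!: integrable_event rand_pred_of_measurable dest: rand_pred_of_bounds)
    then show ?thesis
      unfolding pos_rate_def by (simp add: distrib_right mult.assoc add_divide_distrib)
  qed
  then have "u *\<^sub>R p + v *\<^sub>R q = rate a (\<lambda>\<omega>. u * f \<omega> + v * g \<omega>)"
    by (simp add: f g rates_def)
  then show "u *\<^sub>R p + v *\<^sub>R q \<in> achievable M N Z A Y a"
    using rand_pred_of_convex[OF f(1) g(1) uv] by (auto simp: achievable_def)
qed

lemma achievable_in_cbox:
  assumes "Z \<in> measurable M N"
  shows "achievable M N Z A Y a \<subseteq> cbox (0,0) (1,1)"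
proof -
  have "rate a f \<in> cbox (0,0) (1,1)" if "rand_pred_of M N Z A f" for f
    using that assms A by (intro rate_in_cbox) (auto intro: rand_pred_of_measurable dest: rand_pred_of_bounds)
  then show ?thesis unfolding achievable_def by blast
qed

text \<open>The region is convex, so only limits of threshold rates need an argument. Along a
  monotone subsequence the rules converge pointwise to the indicator of a Borel event in
  \<open>S\<close>, and dominated convergence carries this over to rates. The hypothesis
  \<open>ind\<close> covers both uses: \<open>S\<close> observed directly, and \<open>S\<close> the
  Bayes regressor as a function of \<open>(X, A)\<close>.\<close>

lemma threshold_hull_subset_achievable:
  assumes Z: "Z \<in> measurable M N" and S [measurable]: "S \<in> borel_measurable M"
    and ind: "\<And>B. B \<in> sets borel \<Longrightarrow> rand_pred_of M N Z A (\<lambda>\<omega>. of_bool (S \<omega> \<in> B))"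
  shows "threshold_hull M A Y S a \<subseteq> achievable M N Z A Y a"
proof -
  have "x \<in> achievable M N Z A Y a"
    if x: "x \<in> closure ((\<lambda>t. rate a (\<lambda>\<omega>. of_bool ((S \<omega> > t) = b))) ` {0..1})" for x b
  proof -
    obtain X where X: "\<And>n. X n \<in> (\<lambda>t. rate a (\<lambda>\<omega>. of_bool ((S \<omega> > t) = b))) ` {0..1}" "X \<longlonglongrightarrow> x"
      using x unfolding closure_sequential by blast
    then have "\<forall>n. \<exists>t. X n = rate a (\<lambda>\<omega>. of_bool ((S \<omega> > t) = b))" by blast
    then obtain t where t: "\<And>n. X n = rate a (\<lambda>\<omega>. of_bool ((S \<omega> > t n) = b))" by metis
    obtain k B where k: "strict_mono k" and B [measurable]: "B \<in> sets borel"
      and ev: "\<And>s. \<forall>\<^sub>F n in sequentially. (s > t (k n)) = (s \<in> B)"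
      using monotone_threshold_limit[of t] by blast
    define C where "C = (if b then B else - B)"
    have C: "C \<in> sets borel" using B by (auto simp: C_def)
    have Ceq: "(s \<in> C) = ((s \<in> B) = b)" for s by (auto simp: C_def)
    have lim: "(\<lambda>n. of_bool ((S \<omega> > t (k n)) = b) :: real) \<longlonglongrightarrow> of_bool (S \<omega> \<in> C)" for \<omega>
      using ev[of "S \<omega>"] by (intro tendsto_eventually) (auto simp: Ceq elim: eventually_mono)
    have [measurable]: "(\<lambda>\<omega>. of_bool (S \<omega> \<in> C) :: real) \<in> borel_measurable M"
      using C by measurable
    have "(\<lambda>n. X (k n)) \<longlonglongrightarrow> rate a (\<lambda>\<omega>. of_bool (S \<omega> \<in> C))"
      unfolding t rates_def by (intro tendsto_Pair pos_rate_tendsto lim) auto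
    then have "x = rate a (\<lambda>\<omega>. of_bool (S \<omega> \<in> C))"
      using LIMSEQ_subseq_LIMSEQ[OF X(2) k] by (intro LIMSEQ_unique) (auto simp: o_def)
    then show ?thesis using ind[OF C] by (auto simp: achievable_def)
  qed
  then show ?thesis
    unfolding threshold_hull_def by (intro hull_minimal convex_achievable[OF Z]) auto
qed

lemma diagonal_achievable:
  assumes "0 \<le> c" "c \<le> 1"
  shows "(c, c) \<in> achievable M N Z A Y a"
proof -
  have "rate a (\<lambda>_. c) = (c, c)" by (simp add: rates_def pos_rate_const)
  then show ?thesis using rand_pred_of_const[OF assms] unfolding achievable_def by force
qed

lemma achievable_combine:
  assumes "p \<in> achievable M N Z A Y False" "q \<in> achievable M N Z A Y True"
  obtains f where "rand_pred_of M N Z A f" "rate False f = p" "rate True f = q"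
proof -
  obtain g h where g: "rand_pred_of M N Z A g" "p = rate False g"
    and h: "rand_pred_of M N Z A h" "q = rate True h"
    using assms unfolding achievable_def by blast
  obtain f where f: "rand_pred_of M N Z A f"
    "\<And>\<omega>. \<omega> \<in> space M \<Longrightarrow> A \<omega> = False \<Longrightarrow> f \<omega> = g \<omega>"
    "\<And>\<omega>. \<omega> \<in> space M \<Longrightarrow> A \<omega> = True \<Longrightarrow> f \<omega> = h \<omega>"
    using rand_pred_of_combine[OF g(1) h(1)] by blast
  have "rate False f = p" "rate True f = q"
    unfolding g h using f by (intro rate_cong; blast)+
  with f(1) show ?thesis by (rule that)
qed

lemma exp_loss_rand_pred:
  assumes "rand_pred_of M N Z A f" "Z \<in> measurable M N"
  shows "exp_loss M Y l f = (\<integral>\<omega>. l False (Y \<omega>) \<partial>M) + rates_loss M A Y l (rate False f) (rate True f)"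
  using assms A by (intro exp_loss_rates) (auto intro: rand_pred_of_measurable dest: rand_pred_of_bounds)

lemma event_total:
  "measure M (E False False) + measure M (E True False) + measure M (E False True) + measure M (E True True) = 1"
proof -
  have i: "integrable M (indicator (E a y) :: 'a \<Rightarrow> real)" for a y
    by (rule integrable_bounded[of _ 1]) (auto simp: indicator_def)
  have "1 = (\<integral>\<omega>. (1 :: real) \<partial>M)" by (simp add: prob_space)
  also have "\<dots> = (\<integral>\<omega>. indicator (E False False) \<omega> + indicator (E True False) \<omega>
      + indicator (E False True) \<omega> + indicator (E True True) \<omega> \<partial>M)"
    by (intro Bochner_Integration.integral_cong refl) (auto simp: indicator_def event_ay_def)
  finally show ?thesis using i by simp
qed

text \<open>The cell masses sum to 1, so the change in loss is a weighted average of four terms. A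
  bound on each term thus bounds the total, without adding up over groups or labels.\<close>

lemma rates_loss_le:
  assumes "(l True False - l False False) * (fst p' - fst p) \<le> d"
    "(l True False - l False False) * (fst q' - fst q) \<le> d"
    "(l True True - l False True) * (snd p' - snd p) \<le> d"
    "(l True True - l False True) * (snd q' - snd q) \<le> d"
  shows "rates_loss M A Y l p' q' \<le> rates_loss M A Y l p q + d"
proof -
  have "rates_loss M A Y l p' q' - rates_loss M A Y l p q =
      measure M (E False False) * ((l True False - l False False) * (fst p' - fst p))
    + measure M (E True False) * ((l True False - l False False) * (fst q' - fst q))
    + measure M (E False True) * ((l True True - l False True) * (snd p' - snd p))
    + measure M (E True True) * ((l True True - l False True) * (snd q' - snd q))"
    by (simp add: rates_loss_def algebra_simps)
  also have "\<dots> \<le> measure M (E False False) * d + measure M (E True False) * d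
      + measure M (E False True) * d + measure M (E True True) * d"
    by (intro add_mono mult_left_mono assms) auto
  also have "\<dots> = d" using event_total by (simp flip: distrib_right)
  finally show ?thesis by simp
qed

section \<open>Threshold rates and the conditional Kolmogorov distance\<close>

lemma pos_rate_threshold:
  assumes [measurable]: "S \<in> borel_measurable M"
  shows "pos_rate M A Y (\<lambda>\<omega>. of_bool ((S \<omega> > t) = b)) a y =
    (if b then cond_tail M A Y S a y t else 1 - cond_tail M A Y S a y t)"
proof -
  let ?F = "{\<omega> \<in> E a y. S \<omega> > t}"
  have F: "?F = E a y \<inter> {\<omega> \<in> space M. S \<omega> > t}" by (auto simp: event_ay_def)
  have [measurable]: "?F \<in> sets M" unfolding F by measurable
  have i: "integrable M (indicator B :: 'a \<Rightarrow> real)" if "B \<in> sets M" for B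
    using that by (intro integrable_bounded[of _ 1]) (auto simp: indicator_def)
  have "(\<integral>\<omega>. (of_bool ((S \<omega> > t) = b) :: real) * indicator (E a y) \<omega> \<partial>M) =
      (if b then measure M ?F else measure M (E a y) - measure M ?F)"
  proof (cases b)
    case True
    then have "(\<integral>\<omega>. (of_bool ((S \<omega> > t) = b) :: real) * indicator (E a y) \<omega> \<partial>M) = (\<integral>\<omega>. indicator ?F \<omega> \<partial>M)"
      by (intro Bochner_Integration.integral_cong) (auto simp: indicator_def)
    then show ?thesis using True by simp
  next
    case False
    then have "(\<integral>\<omega>. (of_bool ((S \<omega> > t) = b) :: real) * indicator (E a y) \<omega> \<partial>M)
        = (\<integral>\<omega>. indicator (E a y) \<omega> - indicator ?F \<omega> \<partial>M)"
      by (intro Bochner_Integration.integral_cong) (auto simp: indicator_def)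
    also have "\<dots> = measure M (E a y) - measure M ?F" using i by simp
    finally show ?thesis using False by simp
  qed
  then show ?thesis
    using pos[of a y] by (simp add: pos_rate_def cond_tail_def diff_divide_distrib)
qed

lemma dK_bound:
  assumes [measurable]: "S \<in> borel_measurable M" "S' \<in> borel_measurable M" and t: "0 \<le> t" "t \<le> 1"
  shows "\<bar>cond_tail M A Y S a y t - cond_tail M A Y S' a y t\<bar> \<le> dK M A Y S S'"
proof -
  have *: "0 \<le> cond_tail M A Y S a y t" "cond_tail M A Y S a y t \<le> 1"
    if [measurable]: "S \<in> borel_measurable M" for S a y t
    using pos_rate_bounds[of "\<lambda>\<omega>. of_bool ((S \<omega> > t) = True)" a y] pos_rate_threshold[of S t True a y] that
    by auto
  have "\<bar>cond_tail M A Y S a y t - cond_tail M A Y S' a y t\<bar> \<le> 1" for a y t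
    using *[of S a y t] *[of S' a y t] assms by auto
  \<comment> \<open>A real supremum dominates its terms only over a set that is bounded
    above.\<close>
  then have "bdd_above ((\<lambda>(a, y, t). \<bar>cond_tail M A Y S a y t - cond_tail M A Y S' a y t\<bar>)
      ` (UNIV \<times> UNIV \<times> {0..1}))"
    by (intro bdd_aboveI[of _ 1]) auto
  from cSUP_upper[OF _ this, of "(a, y, t)"] show ?thesis
    using t unfolding dK_def by auto
qed

lemma dK_nonneg:
  assumes "S \<in> borel_measurable M" "S' \<in> borel_measurable M"
  shows "0 \<le> dK M A Y S S'"
  using dK_bound[OF assms, of 0 True True] by linarith

text \<open>The set \<open>T\<close> is the hull for \<open>S\<close> thickened by a box of radius
  \<open>d\<close>. It is convex and closed and contains every threshold rate of \<open>S'\<close>,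
  hence also their closed hull.\<close>

lemma threshold_hull_close:
  assumes S [measurable]: "S \<in> borel_measurable M" and S' [measurable]: "S' \<in> borel_measurable M"
    and p: "p \<in> threshold_hull M A Y S' a"
  defines "d \<equiv> dK M A Y S S'"
  obtains q where "q \<in> threshold_hull M A Y S a" "\<bar>fst q - fst p\<bar> \<le> d" "\<bar>snd q - snd p\<bar> \<le> d"
proof -
  define T where "T = (\<Union>x\<in>threshold_hull M A Y S a. \<Union>z\<in>cbox (-d,-d) (d,d). {x + z})"
  have "convex T"
    unfolding T_def by (intro convex_sums convex_box) (simp add: threshold_hull_def)
  moreover have "closed T"
    unfolding T_def by (intro compact_closed_sums compact_threshold_hull S closed_cbox)
  moreover have "rate a (\<lambda>\<omega>. of_bool ((S' \<omega> > t) = b)) \<in> T" if "t \<in> {0..1}" for t b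
  proof -
    let ?x = "rate a (\<lambda>\<omega>. of_bool ((S \<omega> > t) = b))" and ?x' = "rate a (\<lambda>\<omega>. of_bool ((S' \<omega> > t) = b))"
    have "?x \<in> (\<Union>b. closure ((\<lambda>t. rate a (\<lambda>\<omega>. of_bool ((S \<omega> > t) = b))) ` {0..1}))"
      using that by (intro UN_I[of b] subsetD[OF closure_subset]) auto
    then have "?x \<in> threshold_hull M A Y S a"
      unfolding threshold_hull_def by (rule hull_inc)
    moreover have "?x' - ?x \<in> cbox (-d,-d) (d,d)"
      using that dK_bound[OF S S', of t a False] dK_bound[OF S S', of t a True]
      by (auto simp: rates_def cbox_Pair_iff pos_rate_threshold d_def abs_le_iff)
    ultimately show ?thesis
      unfolding T_def by (intro UN_I[of ?x] UN_I[of "?x' - ?x"]) auto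
  qed
  ultimately have "threshold_hull M A Y S' a \<subseteq> T"
    unfolding threshold_hull_def by (intro hull_minimal UN_least closure_minimal image_subsetI) auto
  then obtain q z where q: "q \<in> threshold_hull M A Y S a" "z \<in> cbox (-d,-d) (d,d)" "p = q + z"
    using p unfolding T_def by blast
  then have "\<bar>fst q - fst p\<bar> \<le> d" "\<bar>snd q - snd p\<bar> \<le> d"
    by (cases z; auto simp: cbox_Pair_iff)+
  with q(1) show ?thesis by (rule that)
qed

end

section \<open>The Bayes regressor\<close>

locale featured_population = labelled_population M A Y for M :: "'a measure" and A Y +
  fixes N :: "'b measure" and X :: "'a \<Rightarrow> 'b"
  assumes X [measurable]: "X \<in> measurable M N"
begin

abbreviation "R \<equiv> bayes_reg M N X A Y"
abbreviation "G \<equiv> vimage_algebra (space M) (\<lambda>\<omega>. (X \<omega>, A \<omega>)) (N \<Otimes>\<^sub>M count_space UNIV)"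

lemma features_space: "(\<lambda>\<omega>. (X \<omega>, A \<omega>)) \<in> space M \<rightarrow> space (N \<Otimes>\<^sub>M count_space UNIV)"
  using measurable_space[OF X] by (auto simp: space_pair_measure)

lemma features_subalgebra: "subalgebra M G"
proof -
  have "(\<lambda>\<omega>. (X \<omega>, A \<omega>)) \<in> measurable M (N \<Otimes>\<^sub>M count_space UNIV)" by measurable
  then have "sets G \<subseteq> sets M" by (intro sets_image_in_sets) auto
  then show ?thesis by (simp add: subalgebra_def)
qed

sublocale features: finite_measure_subalgebra M G
  by unfold_locales (rule features_subalgebra)

lemma bayes_measurable [measurable]: "R \<in> borel_measurable M"
  unfolding bayes_reg_def by simp

lemma bayes_bounds: "AE \<omega> in M. 0 \<le> R \<omega> \<and> R \<omega> \<le> 1"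
proof -
  have i: "integrable M (\<lambda>\<omega>. of_bool (Y \<omega>) :: real)"
    by (rule integrable_bounded[of _ 1]) auto
  have "AE \<omega> in M. 0 \<le> R \<omega>" "AE \<omega> in M. R \<omega> \<le> 1"
    unfolding bayes_reg_def
    by (intro features.real_cond_exp_ge_c i features.real_cond_exp_le_c AE_I2; simp)+
  then show ?thesis by auto
qed

text \<open>\<open>R\<close> is measurable for the sigma-algebra generated by \<open>(X, A)\<close>,
  so an event in \<open>R\<close> is the preimage under \<open>(X, A)\<close> of a measurable set
  \<open>C\<close>, whose indicator serves as the rule.\<close>

lemma bayes_rand_pred:
  assumes "B \<in> sets borel"
  shows "rand_pred_of M N X A (\<lambda>\<omega>. of_bool (R \<omega> \<in> B))"
proof -
  have "R \<in> borel_measurable G" unfolding bayes_reg_def by simp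
  then have "R -` B \<inter> space M \<in> sets G"
    using measurable_sets[of R G borel B] assms by simp
  then obtain C where C: "C \<in> sets (N \<Otimes>\<^sub>M count_space UNIV)"
    and eq: "R -` B \<inter> space M = (\<lambda>\<omega>. (X \<omega>, A \<omega>)) -` C \<inter> space M"
    unfolding sets_vimage_algebra2[OF features_space] by auto
  have "(\<lambda>(z, a). indicator C (z, a) :: real) \<in> borel_measurable (N \<Otimes>\<^sub>M count_space UNIV)"
    using C by simp
  moreover have "of_bool (R \<omega> \<in> B) = (indicator C (X \<omega>, A \<omega>) :: real)" if "\<omega> \<in> space M" for \<omega>
    using eq that by (auto simp: indicator_def)
  ultimately show ?thesis
    unfolding rand_pred_of_def by (intro exI[of _ "\<lambda>z a. indicator C (z, a)"]) auto
qed

lemma rand_pred_features_measurable: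
  assumes "rand_pred_of M N X A f"
  shows "f \<in> borel_measurable G" "A \<in> measurable G (count_space UNIV)"
proof -
  note XA = measurable_vimage_algebra1[OF features_space]
  obtain p where p: "(\<lambda>(z, a). p z a) \<in> borel_measurable (N \<Otimes>\<^sub>M count_space UNIV)"
    and f: "\<And>\<omega>. \<omega> \<in> space M \<Longrightarrow> f \<omega> = p (X \<omega>) (A \<omega>)"
    using assms unfolding rand_pred_of_def by blast
  show "f \<in> borel_measurable G"
    using measurable_compose[OF XA p] f
    by (subst measurable_cong[where g = "\<lambda>\<omega>. p (X \<omega>) (A \<omega>)"]) auto
  show "A \<in> measurable G (count_space UNIV)"
    using measurable_compose[OF XA measurable_snd] by simp
qed

text \<open>The tower property: \<open>f\<close> restricted to group \<open>a\<close> is a function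
  of \<open>(X, A)\<close>, so under the integral the label may be replaced by \<open>R\<close>. A
  linear functional of the rates becomes an integral of \<open>f\<close> against a pointwise weight
  that is affine in \<open>R\<close>.\<close>

lemma rate_inner_bayes:
  fixes u v :: real
  assumes f: "rand_pred_of M N X A f"
  shows "integrable M (\<lambda>\<omega>. f \<omega> * of_bool (A \<omega> = a) * (u * (1 - R \<omega>) + v * R \<omega>))"
    and "(\<integral>\<omega>. f \<omega> * of_bool (A \<omega> = a) * (u * (1 - R \<omega>) + v * R \<omega>) \<partial>M)
      = u * (measure M (E a False) * pos_rate M A Y f a False)
      + v * (measure M (E a True) * pos_rate M A Y f a True)"
proof -
  note [measurable] = rand_pred_features_measurable[OF f]
  note fM [measurable] = rand_pred_of_measurable[OF f X A]
  note bd = rand_pred_of_bounds[OF f]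
  let ?g = "\<lambda>\<omega>. f \<omega> * of_bool (A \<omega> = a)"
  have g: "?g \<in> borel_measurable G" by measurable
  have gY: "integrable M (\<lambda>\<omega>. ?g \<omega> * of_bool (Y \<omega>))" and gi: "integrable M ?g"
    using bd by (intro integrable_bounded[of _ 1]; force)+
  have RI: "integrable M (\<lambda>\<omega>. ?g \<omega> * R \<omega>)"
    and RE: "(\<integral>\<omega>. ?g \<omega> * R \<omega> \<partial>M) = (\<integral>\<omega>. ?g \<omega> * of_bool (Y \<omega>) \<partial>M)"
    unfolding bayes_reg_def
    by (intro features.real_cond_exp_intg gY g; measurable)+
  have eq: "f \<omega> * of_bool (A \<omega> = a) * (u * (1 - R \<omega>) + v * R \<omega>) = u * ?g \<omega> + (v - u) * (?g \<omega> * R \<omega>)" for \<omega>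
    by (simp add: algebra_simps)
  show "integrable M (\<lambda>\<omega>. f \<omega> * of_bool (A \<omega> = a) * (u * (1 - R \<omega>) + v * R \<omega>))"
    unfolding eq using RI gi by simp
  have ev: "(\<integral>\<omega>. f \<omega> * indicator (E a y) \<omega> \<partial>M) = measure M (E a y) * pos_rate M A Y f a y" for y
    using pos[of a y] by (simp add: pos_rate_def)
  have ei: "integrable M (\<lambda>\<omega>. f \<omega> * indicator (E a y) \<omega>)" for y
    using bd fM by (intro integrable_event) auto
  have T: "(\<integral>\<omega>. ?g \<omega> * of_bool (Y \<omega>) \<partial>M) = measure M (E a True) * pos_rate M A Y f a True"
    unfolding ev[symmetric]
    by (intro Bochner_Integration.integral_cong) (auto simp: event_ay_def indicator_def)
  have "(\<integral>\<omega>. ?g \<omega> \<partial>M) = (\<integral>\<omega>. f \<omega> * indicator (E a False) \<omega> + f \<omega> * indicator (E a True) \<omega> \<partial>M)"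
    by (intro Bochner_Integration.integral_cong) (auto simp: event_ay_def indicator_def)
  also have "\<dots> = measure M (E a False) * pos_rate M A Y f a False
      + measure M (E a True) * pos_rate M A Y f a True"
    using ei by (simp add: ev)
  finally show "(\<integral>\<omega>. f \<omega> * of_bool (A \<omega> = a) * (u * (1 - R \<omega>) + v * R \<omega>) \<partial>M)
      = u * (measure M (E a False) * pos_rate M A Y f a False)
      + v * (measure M (E a True) * pos_rate M A Y f a True)"
    unfolding eq using RI gi RE T by (simp add: algebra_simps)
qed

text \<open>A rate pair outside the compact convex hull could be strictly separated from it. The
  separating functional is an integral of the predictor against a weight, which is minimized
  pointwise by predicting 1 where the weight is negative and 0 where it is positive. That rule is a
  threshold rule on \<open>R\<close>, so its rates lie in the hull, a contradiction.\<close>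

lemma neyman_pearson: "achievable M N X A Y a \<subseteq> threshold_hull M A Y R a"
proof (rule ccontr)
  assume "\<not> ?thesis"
  then obtain f where f: "rand_pred_of M N X A f" and out: "rate a f \<notin> threshold_hull M A Y R a"
    unfolding achievable_def by blast
  have "convex (threshold_hull M A Y R a)" by (simp add: threshold_hull_def)
  then obtain w \<beta> where w: "inner w (rate a f) < \<beta>" "\<And>x. x \<in> threshold_hull M A Y R a \<Longrightarrow> \<beta> < inner w x"
    using separating_hyperplane_closed_point[OF _ compact_imp_closed[OF compact_threshold_hull[OF bayes_measurable]] out]
    by metis
  \<comment> \<open>Dividing by the cell masses cancels the masses that appear in
    \<open>rate_inner_bayes\<close>.\<close>
  define u where "u = fst w / measure M (E a False)"
  define v where "v = snd w / measure M (E a True)"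
  have uv: "u * (measure M (E a False) * x) = fst w * x" "v * (measure M (E a True) * x) = snd w * x" for x
    using pos[of a False] pos[of a True] by (auto simp: u_def v_def)
  obtain t b where t: "0 \<le> t" "t \<le> 1"
    and neg: "\<And>r. 0 \<le> r \<Longrightarrow> r \<le> 1 \<Longrightarrow> u * (1 - r) + v * r < 0 \<Longrightarrow> (r > t) = b"
    and nonneg: "\<And>r. 0 \<le> r \<Longrightarrow> r \<le> 1 \<Longrightarrow> u * (1 - r) + v * r > 0 \<Longrightarrow> (r > t) \<noteq> b"
    using threshold_optimal[of u v] by metis
  define g where "g = (\<lambda>\<omega>. of_bool ((R \<omega> > t) = b) :: real)"
  have "{r. (r > t) = b} \<in> sets borel" by (cases b) simp_all
  from bayes_rand_pred[OF this] have g: "rand_pred_of M N X A g" by (simp add: g_def)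
  have "rate a g \<in> threshold_hull M A Y R a"
    unfolding threshold_hull_def g_def using t
    by (intro hull_inc UN_I[of b] subsetD[OF closure_subset]) auto
  then have "inner w (rate a f) < inner w (rate a g)" using w(1) w(2)[of "rate a g"] by simp
  moreover have "inner w (rate a g) \<le> inner w (rate a f)"
  proof -
    have eq: "inner w (rate a h) = (\<integral>\<omega>. h \<omega> * of_bool (A \<omega> = a) * (u * (1 - R \<omega>) + v * R \<omega>) \<partial>M)"
      if "rand_pred_of M N X A h" for h
      unfolding rate_inner_bayes(2)[OF that] uv by (cases w) (simp add: rates_def)
    have le: "g \<omega> * of_bool (A \<omega> = a) * (u * (1 - R \<omega>) + v * R \<omega>)
        \<le> f \<omega> * of_bool (A \<omega> = a) * (u * (1 - R \<omega>) + v * R \<omega>)"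
      if R: "0 \<le> R \<omega>" "R \<omega> \<le> 1" and \<omega>: "\<omega> \<in> space M" for \<omega>
    proof -
      let ?c = "u * (1 - R \<omega>) + v * R \<omega>"
      have "g \<omega> * ?c \<le> f \<omega> * ?c"
      proof (cases "?c" "0 :: real" rule: linorder_cases)
        case less
        then have "g \<omega> = 1" using neg[OF R] by (simp add: g_def)
        then show ?thesis using less rand_pred_of_bounds[OF f \<omega>] by (simp add: mult_right_mono_neg[of _ 1, simplified])
      next
        case greater
        then have "g \<omega> = 0" using nonneg[OF R] by (simp add: g_def)
        then show ?thesis using greater rand_pred_of_bounds[OF f \<omega>] by simp
      qed simp
      then show ?thesis by (cases "A \<omega> = a") auto
    qed
    show ?thesis
      unfolding eq[OF f] eq[OF g]
    proof (intro integral_mono_AE rate_inner_bayes(1) f g)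
      show "AE \<omega> in M. g \<omega> * of_bool (A \<omega> = a) * (u * (1 - R \<omega>) + v * R \<omega>)
          \<le> f \<omega> * of_bool (A \<omega> = a) * (u * (1 - R \<omega>) + v * R \<omega>)"
        \<comment> \<open>\<open>R\<close> is one version of the conditional expectation and is
          known to lie in the unit interval only almost everywhere.\<close>
        using bayes_bounds AE_space
      proof eventually_elim
        case (elim \<omega>)
        then show ?case using le[of \<omega>] by simp
      qed
    qed
  qed
  ultimately show False by simp
qed

text \<open>This makes the region reachable from \<open>(X, A)\<close> compact, which is what the
  existence of optimal predictors rests on.\<close>

lemma achievable_bayes: "achievable M N X A Y a = threshold_hull M A Y R a"
  using neyman_pearson threshold_hull_subset_achievable[OF X bayes_measurable bayes_rand_pred] by blast

text \<open>Fairness enters as a closed condition \<open>C\<close> on the two rate pairs. The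
  continuous loss attains its minimum on the compact feasible set, which is nonempty since the
  constant predictor 0 is fair.\<close>

lemma optimal_fair_exists:
  assumes C: "closed C" "((0,0),(0,0)) \<in> C"
    and fair: "\<And>f. fair f = ((rate False f, rate True f) \<in> C)"
  obtains f where "optimal_fair M N X A Y l fair f"
proof -
  let ?K = "(achievable M N X A Y False \<times> achievable M N X A Y True) \<inter> C"
  have "compact ?K"
    unfolding achievable_bayes
    by (intro compact_Int_closed compact_Times compact_threshold_hull C) auto
  moreover have "((0,0),(0,0)) \<in> ?K" using diagonal_achievable[of 0 N X] C by simp
  moreover have "continuous_on ?K (\<lambda>x. rates_loss M A Y l (fst x) (snd x))"
    unfolding rates_loss_def by (intro continuous_intros)
  ultimately have "\<exists>x\<in>?K. \<forall>z\<in>?K. rates_loss M A Y l (fst x) (snd x) \<le> rates_loss M A Y l (fst z) (snd z)"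
    by (intro continuous_attains_inf) auto
  then obtain x where x: "x \<in> ?K"
    and min: "\<And>z. z \<in> ?K \<Longrightarrow> rates_loss M A Y l (fst x) (snd x) \<le> rates_loss M A Y l (fst z) (snd z)"
    by blast
  have "fst x \<in> achievable M N X A Y False" "snd x \<in> achievable M N X A Y True"
    using x by (auto simp: mem_Times_iff)
  then obtain f where f: "rand_pred_of M N X A f" "rate False f = fst x" "rate True f = snd x"
    by (rule achievable_combine)
  have "exp_loss M Y l f \<le> exp_loss M Y l g" if g: "rand_pred_of M N X A g" "fair g" for g
  proof -
    have "(rate False g, rate True g) \<in> ?K" using g fair by (auto simp: achievable_def)
    from min[OF this] show ?thesis
      using exp_loss_rand_pred[OF f(1) X] exp_loss_rand_pred[OF g(1) X] f by simp
  qed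
  then have "optimal_fair M N X A Y l fair f"
    unfolding optimal_fair_def using f x fair by auto
  then show ?thesis by (rule that)
qed

end

section \<open>Predictors derived from a score\<close>

locale scored_population = featured_population M A Y N X
  for M :: "'a measure" and A Y and N :: "'b measure" and X +
  fixes S :: "'a \<Rightarrow> real" and l :: "bool \<Rightarrow> bool \<Rightarrow> real"
  assumes S [measurable]: "S \<in> borel_measurable M"
    and l: "0 \<le> l u v" "l u v \<le> 1"
begin

abbreviation "d \<equiv> dK M A Y S R"

lemma loss_slope: "\<bar>l True y - l False y\<bar> \<le> 1"
  using l[of True y] l[of False y] by (auto simp: abs_le_iff)

lemma score_rand_pred:
  assumes "B \<in> sets borel"
  shows "rand_pred_of M borel S A (\<lambda>\<omega>. of_bool (S \<omega> \<in> B))"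
proof -
  have "(\<lambda>(z, a). of_bool (z \<in> B) :: real) \<in> borel_measurable (borel \<Otimes>\<^sub>M count_space (UNIV :: bool set))"
    using assms by measurable
  then show ?thesis
    unfolding rand_pred_of_def by (intro exI[of _ "\<lambda>z a. of_bool (z \<in> B)"]) auto
qed

abbreviation "K \<equiv> achievable M borel S A Y"

lemma score_region:
  "convex (K a)" "(0,0) \<in> K a" "(1,1) \<in> K a" "K a \<subseteq> cbox (0,0) (1,1)"
  using diagonal_achievable[of 0 borel S a] diagonal_achievable[of 1 borel S a]
    convex_achievable[OF S] achievable_in_cbox[OF S] by simp_all

text \<open>Neyman-Pearson places the rates in the hull for \<open>R\<close>, a shift of at most
  \<open>d\<close> per coordinate leads to the hull for the score, and that hull is reachable from
  the score.\<close>

lemma score_region_close: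
  assumes "rand_pred_of M N X A f"
  obtains q where "q \<in> K a" "\<bar>fst q - fst (rate a f)\<bar> \<le> d" "\<bar>snd q - snd (rate a f)\<bar> \<le> d"
proof -
  have "rate a f \<in> threshold_hull M A Y R a"
    using assms neyman_pearson by (auto simp: achievable_def)
  then obtain q where "q \<in> threshold_hull M A Y S a"
    "\<bar>fst q - fst (rate a f)\<bar> \<le> d" "\<bar>snd q - snd (rate a f)\<bar> \<le> d"
    using threshold_hull_close[OF S bayes_measurable] by blast
  moreover have "threshold_hull M A Y S a \<subseteq> K a"
    by (intro threshold_hull_subset_achievable S score_rand_pred)
  ultimately show ?thesis using that by blast
qed

lemma derived_predictor:
  assumes f: "rand_pred_of M N X A f" and r: "r \<in> K False" "r' \<in> K True"
    and le: "rates_loss M A Y l r r' \<le> rates_loss M A Y l (rate False f) (rate True f) + d"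
  obtains g where "rand_pred_of M borel S A g" "rate False g = r" "rate True g = r'"
    "exp_loss M Y l g \<le> exp_loss M Y l f + 2 * sqrt 2 * d"
proof -
  obtain g where g: "rand_pred_of M borel S A g" "rate False g = r" "rate True g = r'"
    using achievable_combine[OF r] by blast
  \<comment> \<open>The excess loss is at most \<open>d\<close>; as \<open>d\<close> is nonnegative,
    the stated factor only weakens this.\<close>
  have "1 \<le> sqrt (2 :: real)" by simp
  then have "1 * d \<le> 2 * sqrt 2 * d"
    using dK_nonneg[OF S bayes_measurable] by (intro mult_right_mono) linarith+
  then have "exp_loss M Y l g \<le> exp_loss M Y l f + 2 * sqrt 2 * d"
    using le g exp_loss_rand_pred[OF f X] exp_loss_rand_pred[OF g(1) S] by simp
  with g show ?thesis by (rule that)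
qed

lemma equalized_odds_rates: "equalized_odds M A Y f = (rate False f = rate True f)"
  by (auto simp: equalized_odds_def rates_def all_bool_eq)

lemma equal_opportunity_rates: "equal_opportunity M A Y f = (snd (rate False f) = snd (rate True f))"
  by (simp add: equal_opportunity_def rates_def)

lemma equalized_odds_near_optimal:
  obtains f g where "optimal_fair M N X A Y l (equalized_odds M A Y) f"
    "rand_pred_of M borel S A g" "equalized_odds M A Y g"
    "exp_loss M Y l g \<le> exp_loss M Y l f + 2 * sqrt 2 * d"
proof -
  have "closed {x :: (real \<times> real) \<times> (real \<times> real). fst x = snd x}"
    by (intro closed_Collect_eq continuous_intros)
  then obtain f where f: "optimal_fair M N X A Y l (equalized_odds M A Y) f"
    using optimal_fair_exists[of "{x. fst x = snd x}" "equalized_odds M A Y" l]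
    by (auto simp: equalized_odds_rates)
  then have fX: "rand_pred_of M N X A f" and eq: "rate False f = rate True f"
    by (auto simp: optimal_fair_def equalized_odds_rates)
  obtain q where q: "q \<in> K False" "\<bar>fst q - fst (rate False f)\<bar> \<le> d" "\<bar>snd q - snd (rate False f)\<bar> \<le> d"
    using score_region_close[OF fX] by blast
  obtain q' where q': "q' \<in> K True" "\<bar>fst q' - fst (rate False f)\<bar> \<le> d" "\<bar>snd q' - snd (rate False f)\<bar> \<le> d"
    using score_region_close[OF fX, of True] by (metis eq)
  \<comment> \<open>Both groups share one optimal rate pair, so both neighbours lie in the same box
    around it, and so does the common point \<open>r\<close>.\<close>
  let ?B = "cbox (rate False f - (d,d)) (rate False f + (d,d))"
  have B: "x \<in> ?B \<longleftrightarrow> \<bar>fst x - fst (rate False f)\<bar> \<le> d \<and> \<bar>snd x - snd (rate False f)\<bar> \<le> d" for x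
    by (cases x; cases "rate False f") (auto simp: cbox_Pair_iff abs_le_iff)
  obtain r where "r \<in> K False \<inter> K True \<inter> ?B"
    using diagonal_convex_common_point[OF score_region score_region q(1) q'(1)]
      B[THEN iffD2, OF conjI, OF q(2,3)] B[THEN iffD2, OF conjI, OF q'(2,3)] by blast
  then have r: "r \<in> K False" "r \<in> K True" "\<bar>fst r - fst (rate False f)\<bar> \<le> d" "\<bar>snd r - snd (rate False f)\<bar> \<le> d"
    using B by auto
  have "rates_loss M A Y l r r \<le> rates_loss M A Y l (rate False f) (rate True f) + d"
    using r loss_slope eq by (intro rates_loss_le signed_product_le) auto
  then obtain g where "rand_pred_of M borel S A g" "rate False g = r" "rate True g = r"
    "exp_loss M Y l g \<le> exp_loss M Y l f + 2 * sqrt 2 * d"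
    using derived_predictor[OF fX r(1,2)] by blast
  then show ?thesis using that[OF f] by (simp add: equalized_odds_rates)
qed

text \<open>Only true positive rates must agree, and the optimal false positive rates may differ
  between groups, so no single box is available. Instead the two neighbours are brought to one true
  positive rate while the cost of the false positive rates does not rise.\<close>

lemma equal_opportunity_near_optimal:
  obtains f g where "optimal_fair M N X A Y l (equal_opportunity M A Y) f"
    "rand_pred_of M borel S A g" "equal_opportunity M A Y g"
    "exp_loss M Y l g \<le> exp_loss M Y l f + 2 * sqrt 2 * d"
proof -
  have "closed {x :: (real \<times> real) \<times> (real \<times> real). snd (fst x) = snd (snd x)}"
    by (intro closed_Collect_eq continuous_intros)
  then obtain f where f: "optimal_fair M N X A Y l (equal_opportunity M A Y) f"
    using optimal_fair_exists[of "{x. snd (fst x) = snd (snd x)}" "equal_opportunity M A Y" l]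
    by (auto simp: equal_opportunity_rates)
  then have fX: "rand_pred_of M N X A f" and eq: "snd (rate False f) = snd (rate True f)"
    by (auto simp: optimal_fair_def equal_opportunity_rates)
  obtain q where q: "q \<in> K False" "\<bar>fst q - fst (rate False f)\<bar> \<le> d" "\<bar>snd q - snd (rate False f)\<bar> \<le> d"
    using score_region_close[OF fX] by blast
  obtain q' where q': "q' \<in> K True" "\<bar>fst q' - fst (rate True f)\<bar> \<le> d" "\<bar>snd q' - snd (rate True f)\<bar> \<le> d"
    using score_region_close[OF fX, of True] by blast
  let ?c = "l True False - l False False"
  have box: "q \<in> cbox (0,0) (1,1)" "q' \<in> cbox (0,0) (1,1)"
    using q q' score_region(4) by auto
  obtain r r' where r: "r \<in> K False" "r' \<in> K True" "snd r = snd r'" "snd r \<in> {snd q, snd q'}"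
    "?c * fst r \<le> ?c * fst q" "?c * fst r' \<le> ?c * fst q'"
  \<comment> \<open>The groups exchange roles according to which neighbour has the larger true
    positive rate.\<close>
  proof (cases "snd q \<le> snd q'")
    case True
    show ?thesis
      by (rule level_second_coordinate[OF score_region(1,3)[of False] score_region(1,2)[of True] q(1) q'(1) True box, of ?c])
        (rule that)
  next
    case False
    then have "snd q' \<le> snd q" by simp
    then show ?thesis
      by (rule level_second_coordinate[OF score_region(1,3)[of True] score_region(1,2)[of False] q'(1) q(1) _ box(2,1), of ?c])
        (rule that; auto)
  qed
  have "?c * (fst q - fst (rate False f)) \<le> d" "?c * (fst q' - fst (rate True f)) \<le> d"
    using q q' loss_slope by (intro signed_product_le; blast)+
  \<comment> \<open>The first coordinates may have moved by more than \<open>d\<close>, but only in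
    the direction that does not increase the loss.\<close>
  then have "?c * (fst r - fst (rate False f)) \<le> d" "?c * (fst r' - fst (rate True f)) \<le> d"
    using r(5,6) by (simp_all add: right_diff_distrib)
  then have "rates_loss M A Y l r r' \<le> rates_loss M A Y l (rate False f) (rate True f) + d"
  proof (rule rates_loss_le)
    \<comment> \<open>The common level is the true positive rate of \<open>q\<close> or of
      \<open>q'\<close>, each within \<open>d\<close> of the optimal one, which both groups
      share.\<close>
    show "(l True True - l False True) * (snd r - snd (rate False f)) \<le> d"
      "(l True True - l False True) * (snd r' - snd (rate True f)) \<le> d"
      using r(3,4) q q' loss_slope eq by (intro signed_product_le; auto)+
  qed
  then obtain g where "rand_pred_of M borel S A g" "rate False g = r" "rate True g = r'"
    "exp_loss M Y l g \<le> exp_loss M Y l f + 2 * sqrt 2 * d"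
    using derived_predictor[OF fX r(1,2)] by blast
  then show ?thesis using that[OF f] r(3) by (simp add: equal_opportunity_rates)
qed

end

theorem theorem5p6:
  fixes M :: "'a measure" and N :: "'b measure" and X :: "'a \<Rightarrow> 'b"
    and A Y :: "'a \<Rightarrow> bool" and Rh :: "'a \<Rightarrow> real" and l :: "bool \<Rightarrow> bool \<Rightarrow> real"
  assumes "prob_space M"
    and "X \<in> measurable M N"
    and "A \<in> measurable M (count_space UNIV)"
    and "Y \<in> measurable M (count_space UNIV)"
    and "Rh \<in> borel_measurable M"
    and "\<forall>\<omega>\<in>space M. 0 \<le> Rh \<omega> \<and> Rh \<omega> \<le> 1"
    and "\<forall>u v. 0 \<le> l u v \<and> l u v \<le> 1"
    and "\<forall>a y. measure M (event_ay M A Y a y) > 0"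
  shows "(\<exists>Ystar Yh.
            optimal_fair M N X A Y l (equalized_odds M A Y) Ystar \<and>
            rand_pred_of M borel Rh A Yh \<and> equalized_odds M A Y Yh \<and>
            exp_loss M Y l Yh \<le> exp_loss M Y l Ystar
              + 2 * sqrt 2 * dK M A Y Rh (bayes_reg M N X A Y)) \<and>
         (\<exists>Ystar Yh.
            optimal_fair M N X A Y l (equal_opportunity M A Y) Ystar \<and>
            rand_pred_of M borel Rh A Yh \<and> equal_opportunity M A Y Yh \<and>
            exp_loss M Y l Yh \<le> exp_loss M Y l Ystar
              + 2 * sqrt 2 * dK M A Y Rh (bayes_reg M N X A Y))"
proof -
  interpret prob_space M by fact
  interpret scored_population M A Y N X Rh l
    using assms by unfold_locales auto
  show ?thesis
  proof
    show "\<exists>Ystar Yh.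
        optimal_fair M N X A Y l (equalized_odds M A Y) Ystar \<and>
        rand_pred_of M borel Rh A Yh \<and> equalized_odds M A Y Yh \<and>
        exp_loss M Y l Yh \<le> exp_loss M Y l Ystar
          + 2 * sqrt 2 * dK M A Y Rh (bayes_reg M N X A Y)"
      by (rule equalized_odds_near_optimal) blast
    show "\<exists>Ystar Yh.
        optimal_fair M N X A Y l (equal_opportunity M A Y) Ystar \<and>
        rand_pred_of M borel Rh A Yh \<and> equal_opportunity M A Y Yh \<and>
        exp_loss M Y l Yh \<le> exp_loss M Y l Ystar
          + 2 * sqrt 2 * dK M A Y Rh (bayes_reg M N X A Y)"
      by (rule equal_opportunity_near_optimal) blast
  qed
qed

end
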